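(* Let $G$ be a connected strongly regular graph with spectral parameters $\rho,\sigma,f,g$, and let $\mu$ be a positive integer. Then the pair $(G,\mu)$ is feasible if and only if all of the following hold: (a) $\rho$ and $\sigma$ are integers; (b) $-\frac{f+1}{f+g+1}\cdot\frac{f\rho+(g+1)\sigma}{\sigma^2}\le \mu\le -\frac{f+1}{2\sigma}$; (c) $f+1$ divides $g(\rho-\sigma)\mu$; (d) $f+g+1$ divides $fg(\rho-\sigma)\mu$; (e) the quantity $\Delta:=(f+g+1)\big(f+g+1-\frac{4f(\rho-\sigma)\mu}{f+1}\big)$ is a perfect square.
   Context: For a connected strongly regular graph $G$ (not complete), its adjacency matrix has exactly three distinct eigenvalues $a>\rho>\sigma$ with multiplicities $1,f,g$; $\rho,\sigma,f,g$ are its spectral parameters. Given $G$ and a positive integer $\mu$, define $v=f+1$, $b=f+g+1$, and for each root $\lambda$ of $$x^2-\big(f+g+1-2(\rho-\sigma)\mu\big)x+(\rho-\sigma)\mu\Big((\rho-\sigma)\mu-\frac{f+g+1}{f+1}\Big)=0$$ define $r=\lambda+(\rho-\sigma)\mu$, $\lambda_1=\frac{1}{f+g+1}\big((f+1)(\lambda+\rho\mu)+g\sigma\mu\big)$, $\lambda_2=\lambda_1+\mu$, $k=\lambda_1-\sigma\mu$. The pair $(G,\mu)$ is called feasible (for a quasi-symmetric 2-design with block graph $G$ and defect $\mu$) if, for both roots $\lambda$, all of $b,v,r,k,\lambda,\lambda_1,\lambda_2$ are non-negative integers satisfying $bk=rv$ and $r(k-1)=\lambda(v-1)$. (These are exactly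 the parameters that a quasi-symmetric 2-design with block graph $G$ and defect $\mu$, and its complement, would have.) *)

theory Defs
  imports
    "Graph_Theory.Digraph_Component"
    "Jordan_Normal_Form.Char_Poly"
    "HOL.Complex"
begin

text \<open>
  Finite simple graphs are the locale \<open>graph\<close>: symmetric, loop-free digraphs without parallel arcs,
  so \<open>out_degree\<close> is the valency and \<open>arcs_ends\<close> is the adjacency relation.
\<close>

definition common_neighbours :: "('a, 'b) pre_digraph \<Rightarrow> 'a \<Rightarrow> 'a \<Rightarrow> 'a set" where
  "common_neighbours G u v = {w \<in> verts G. u \<rightarrow>\<^bsub>G\<^esub> w \<and> v \<rightarrow>\<^bsub>G\<^esub> w}"

text \<open>Edgeless and complete graphs are excluded; complete multipartite graphs are not.\<close>

definition strongly_regular :: "('a, 'b) pre_digraph \<Rightarrow> bool" where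
  "strongly_regular G \<longleftrightarrow>
     (\<exists>u\<in>verts G. \<exists>v\<in>verts G. u \<rightarrow>\<^bsub>G\<^esub> v) \<and>
     (\<exists>u\<in>verts G. \<exists>v\<in>verts G. u \<noteq> v \<and> \<not> u \<rightarrow>\<^bsub>G\<^esub> v) \<and>
     (\<exists>a c d :: nat.
        (\<forall>u\<in>verts G. out_degree G u = a) \<and>
        (\<forall>u\<in>verts G. \<forall>v\<in>verts G. u \<rightarrow>\<^bsub>G\<^esub> v \<longrightarrow> card (common_neighbours G u v) = c) \<and>
        (\<forall>u\<in>verts G. \<forall>v\<in>verts G. u \<noteq> v \<and> \<not> u \<rightarrow>\<^bsub>G\<^esub> v \<longrightarrow>
            card (common_neighbours G u v) = d))"

text \<open>
  The adjacency matrix is taken with respect to an arbitrary but fixed enumeration of the vertices;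
  another choice conjugates it by a permutation matrix and leaves its spectrum unchanged.
\<close>

definition vertex_list :: "('a, 'b) pre_digraph \<Rightarrow> 'a list" where
  "vertex_list G = (SOME vs. distinct vs \<and> set vs = verts G)"

definition adjacency_matrix :: "('a, 'b) pre_digraph \<Rightarrow> real mat" where
  "adjacency_matrix G =
     mat (card (verts G)) (card (verts G))
       (\<lambda>(i, j). if (vertex_list G ! i) \<rightarrow>\<^bsub>G\<^esub> (vertex_list G ! j) then 1 else 0)"

definition eigenvalue_multiplicity :: "real mat \<Rightarrow> real \<Rightarrow> nat" where
  "eigenvalue_multiplicity A x = order x (char_poly A)"

definition spectral_parameters ::
    "('a, 'b) pre_digraph \<Rightarrow> real \<Rightarrow> real \<Rightarrow> nat \<Rightarrow> nat \<Rightarrow> bool" where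
  "spectral_parameters G \<rho> \<sigma> f g \<longleftrightarrow>
     (\<exists>a. a > \<rho> \<and> \<rho> > \<sigma> \<and>
        {x. eigenvalue (adjacency_matrix G) x} = {a, \<rho>, \<sigma>} \<and>
        eigenvalue_multiplicity (adjacency_matrix G) a = 1 \<and>
        eigenvalue_multiplicity (adjacency_matrix G) \<rho> = f \<and>
        eigenvalue_multiplicity (adjacency_matrix G) \<sigma> = g)"

text \<open>
  The roots \<open>l\<close> range over the complex numbers: with real roots only, the condition would hold
  vacuously whenever the quadratic has negative discriminant.
\<close>

definition feasible_parameters :: "real \<Rightarrow> real \<Rightarrow> nat \<Rightarrow> nat \<Rightarrow> nat \<Rightarrow> bool" where
  "feasible_parameters \<rho> \<sigma> f g \<mu> \<longleftrightarrow>
     (\<forall>l :: complex.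
        l\<^sup>2 - of_real (real (f + g + 1) - 2 * (\<rho> - \<sigma>) * real \<mu>) * l
          + of_real ((\<rho> - \<sigma>) * real \<mu> * ((\<rho> - \<sigma>) * real \<mu> - real (f + g + 1) / real (f + 1))) = 0
        \<longrightarrow>
        (let v = of_nat (f + 1);
             b = of_nat (f + g + 1);
             r = l + of_real ((\<rho> - \<sigma>) * real \<mu>);
             l1 = 1 / of_nat (f + g + 1) *
                    (of_nat (f + 1) * (l + of_real (\<rho> * real \<mu>)) + of_real (real g * \<sigma> * real \<mu>));
             l2 = l1 + of_nat \<mu>;
             k = l1 - of_real (\<sigma> * real \<mu>)
         in {b, v, r, k, l, l1, l2} \<subseteq> \<nat> \<and> b * k = r * v \<and> r * (k - 1) = l * (v - 1)))"

definition feasible :: "('a, 'b) pre_digraph \<Rightarrow> nat \<Rightarrow> bool" where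
  "feasible G \<mu> \<longleftrightarrow>
     (\<exists>\<rho> \<sigma> f g. spectral_parameters G \<rho> \<sigma> f g \<and> feasible_parameters \<rho> \<sigma> f g \<mu>)"

end

theory Submission
  imports Defs
begin

text \<open>
  Put \<open>b = f + g + 1\<close>, \<open>v = f + 1\<close> and \<open>M = (\<rho> - \<sigma>) \<mu>\<close>. In terms of \<open>r = \<lambda> + M\<close> the defining quadratic
  reads \<open>r\<^sup>2 - b r + b M f / v = 0\<close>, with discriminant \<open>\<Delta>\<close>, and \<open>k = v r / b\<close> is a root of
  \<open>k\<^sup>2 - v k + M f v / b = 0\<close>. Hence \<open>b k = r v\<close> and \<open>r (k - 1) = \<lambda> (v - 1)\<close> hold automatically.
  Integrality of both roots \<open>r\<close> amounts to (e) and (c), integrality of both \<open>k\<close> to (d), and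
  \<open>\<lambda>\<^sub>1 = k + \<sigma> \<mu> \<ge> 0\<close> for both roots says that \<open>- \<sigma> \<mu>\<close> lies to the left of both roots of the
  quadratic for \<open>k\<close>, which is (b). The graph contributes only \<open>\<sigma> < 0\<close> and the fact that rational
  eigenvalues are integers: each eigenvalue other than the valency is a root of the
  monic integer quadratic \<open>x\<^sup>2 - (c - d) x - (a - d)\<close>.
\<close>

section \<open>Eigenvalues of strongly regular graphs\<close>

text \<open>Rational root theorem: with \<open>x = p / q\<close> in lowest terms, clearing
  denominators gives \<open>q dvd p\<^sup>2\<close>, and coprimality forces
  \<open>q = 1\<close>.\<close>

lemma rat_root_monic_quadratic_Ints:
  fixes x B C :: real
  assumes "x \<in> \<rat>" "B \<in> \<int>" "C \<in> \<int>" and root: "x\<^sup>2 - B * x + C = 0"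
  shows "x \<in> \<int>"
proof -
  obtain B' C' where B: "B = of_int B'" and C: "C = of_int C'"
    using assms by (auto elim!: Ints_cases)
  obtain r where r: "x = of_rat r" using \<open>x \<in> \<rat>\<close> by (auto elim: Rats_cases)
  obtain p q where pq: "quotient_of r = (p, q)" by force
  have q: "q > 0" and cop: "coprime p q" and "r = of_int p / of_int q"
    using pq quotient_of_denom_pos quotient_of_coprime quotient_of_div by blast+
  then have x: "x = of_int p / of_int q" by (simp add: r of_rat_divide)
  have "(of_int p)\<^sup>2 - B * of_int p * of_int q + C * (of_int q)\<^sup>2 = (x\<^sup>2 - B * x + C) * (of_int q)\<^sup>2"
    using q by (simp add: x field_simps power2_eq_square)
  then have "real_of_int (p\<^sup>2 - B' * p * q + C' * q\<^sup>2) = of_int 0"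
    using root by (simp add: B C)
  then have "p\<^sup>2 - B' * p * q + C' * q\<^sup>2 = 0" by (simp only: of_int_eq_iff)
  then have "p\<^sup>2 = q * (B' * p - C' * q)" by (simp add: algebra_simps power2_eq_square)
  then have "q dvd p\<^sup>2" by simp
  moreover have "coprime (p\<^sup>2) q" using cop by simp
  ultimately have "q = 1" using q by (metis coprime_common_divisor dvd_refl zdvd1_eq abs_of_pos)
  then show ?thesis by (simp add: x)
qed

section \<open>Eigenvectors as functions on the vertices\<close>

lemma vertex_list:
  assumes "finite (verts G)"
  shows "distinct (vertex_list G)" and "set (vertex_list G) = verts G"
proof -
  have "\<exists>vs. distinct vs \<and> set vs = verts G" using finite_distinct_list[OF assms] by blast
  then have "distinct (vertex_list G) \<and> set (vertex_list G) = verts G"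
    unfolding vertex_list_def by (rule someI_ex)
  then show "distinct (vertex_list G)" and "set (vertex_list G) = verts G" by blast+
qed

text \<open>Transports the eigenvector along the vertex enumeration, so that later arguments are
  sums over neighbourhoods without matrix indices.\<close>

lemma eigenvalue_adjacency_matrixE:
  assumes fin: "finite (verts G)" and ev: "eigenvalue (adjacency_matrix G) x"
  obtains h where "\<exists>u\<in>verts G. h u \<noteq> 0"
    and "\<And>u. u \<in> verts G \<Longrightarrow> (\<Sum>w | w \<in> verts G \<and> u \<rightarrow>\<^bsub>G\<^esub> w. h w) = x * h u"
proof -
  let ?n = "card (verts G)" and ?vs = "vertex_list G" and ?A = "adjacency_matrix G"
  note vl = vertex_list[OF fin]
  have len: "length ?vs = ?n" using vl distinct_card by fastforce
  have bij: "bij_betw ((!) ?vs) {0..<?n} (verts G)"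
    using bij_betw_nth[OF vl(1)] len vl(2) by (metis atLeast0LessThan)
  have dim: "dim_row ?A = ?n" "dim_col ?A = ?n" by (auto simp: adjacency_matrix_def)
  obtain w where w: "w \<in> carrier_vec ?n" "w \<noteq> 0\<^sub>v ?n" "?A *\<^sub>v w = x \<cdot>\<^sub>v w"
    using ev by (auto simp: eigenvalue_def eigenvector_def dim)
  define h where "h u = w $ (inv_into {0..<?n} ((!) ?vs) u)" for u
  have h: "h (?vs ! i) = w $ i" if "i < ?n" for i
    using that bij by (simp add: h_def bij_betw_inv_into_left)
  have "\<exists>i<?n. w $ i \<noteq> 0" using w by (metis carrier_vecD eq_vecI index_zero_vec)
  then obtain i where "i < ?n" "h (?vs ! i) \<noteq> 0" using h by force
  moreover from this have "?vs ! i \<in> verts G" using vl(2) len nth_mem by metis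
  moreover have "(\<Sum>w | w \<in> verts G \<and> u \<rightarrow>\<^bsub>G\<^esub> w. h w) = x * h u" if u: "u \<in> verts G" for u
  proof -
    obtain i where i: "i < ?n" "u = ?vs ! i" using u vl(2) len by (metis in_set_conv_nth)
    have "(\<Sum>w | w \<in> verts G \<and> u \<rightarrow>\<^bsub>G\<^esub> w. h w)
        = (\<Sum>w\<in>verts G. (if u \<rightarrow>\<^bsub>G\<^esub> w then 1 else 0) * h w)"
      using fin by (intro sum.mono_neutral_cong_left) auto
    also have "\<dots> = (\<Sum>j\<in>{0..<?n}. (if u \<rightarrow>\<^bsub>G\<^esub> ?vs ! j then 1 else 0) * h (?vs ! j))"
      using sum.reindex_bij_betw[OF bij, of "\<lambda>w. (if u \<rightarrow>\<^bsub>G\<^esub> w then 1 else 0) * h w"] by simp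
    also have "\<dots> = (\<Sum>j\<in>{0..<?n}. ?A $$ (i, j) * w $ j)"
      using i h by (intro sum.cong) (auto simp: adjacency_matrix_def)
    also have "\<dots> = (?A *\<^sub>v w) $ i" using i w(1) by (simp add: dim scalar_prod_def)
    also have "\<dots> = x * h u" using i w by (simp add: h)
    finally show ?thesis .
  qed
  ultimately show thesis using that by blast
qed

section \<open>The quadratic satisfied by the eigenvalues\<close>

text \<open>\<open>out_degree\<close> counts arcs; without parallel arcs, \<open>head\<close> maps
  the arcs out of \<open>u\<close> injectively onto its neighbours.\<close>

lemma (in graph) out_degree_eq_card_neighbours:
  assumes "u \<in> verts G"
  shows "out_degree G u = card {w \<in> verts G. u \<rightarrow>\<^bsub>G\<^esub> w}"
proof -
  have "inj_on (head G) (out_arcs G u)"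
    by (rule inj_onI) (auto intro!: no_multi_arcs simp: arc_to_ends_def)
  moreover have "head G ` out_arcs G u = {w \<in> verts G. u \<rightarrow>\<^bsub>G\<^esub> w}"
    by (auto simp: arcs_ends_conv image_iff intro: in_arcs_imp_in_arcs_ends)
  ultimately show ?thesis unfolding out_degree_def by (metis card_image)
qed

text \<open>Entrywise form of \<open>A\<^sup>2 = a I + c A + d (J - I - A)\<close> applied to an eigenvector orthogonal to the
  all-one vector.\<close>

lemma (in graph) srg_eigenvalue_quadratic:
  fixes x :: real and a c d :: nat
  assumes deg: "\<And>u. u \<in> verts G \<Longrightarrow> out_degree G u = a"
    and adj: "\<And>u w. \<lbrakk>u \<in> verts G; w \<in> verts G; u \<rightarrow>\<^bsub>G\<^esub> w\<rbrakk> \<Longrightarrow> card (common_neighbours G u w) = c"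
    and nonadj: "\<And>u w. \<lbrakk>u \<in> verts G; w \<in> verts G; u \<noteq> w; \<not> u \<rightarrow>\<^bsub>G\<^esub> w\<rbrakk>
                   \<Longrightarrow> card (common_neighbours G u w) = d"
    and ev: "eigenvalue (adjacency_matrix G) x" and "x \<noteq> real a"
  shows "x\<^sup>2 - (real c - real d) * x + (real d - real a) = 0"
proof -
  let ?V = "verts G"
  define N where "N u = {w \<in> ?V. u \<rightarrow>\<^bsub>G\<^esub> w}" for u
  obtain h where ne: "\<exists>u\<in>?V. h u \<noteq> 0" and h: "\<And>u. u \<in> ?V \<Longrightarrow> sum h (N u) = x * h u"
    using eigenvalue_adjacency_matrixE[OF finite_verts ev] unfolding N_def by metis
  have sym: "u \<rightarrow>\<^bsub>G\<^esub> w \<longleftrightarrow> w \<rightarrow>\<^bsub>G\<^esub> u" for u w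
    using arcs_ends_symmetric[OF sym_arcs] by blast
  have finN: "finite (N u)" for u unfolding N_def by simp
  have cardN: "card (N u) = a" if "u \<in> ?V" for u
    using deg[OF that] out_degree_eq_card_neighbours[OF that] by (simp add: N_def)
  \<comment> \<open>Summing the eigenvector equation over all vertices counts each
    \<open>h w\<close> once per neighbour of \<open>w\<close>, that is \<open>a\<close> times. As
    \<open>x \<noteq> real a\<close>, the total of \<open>h\<close> must vanish.\<close>
  have "(\<Sum>u\<in>?V. sum h (N u)) = (\<Sum>w\<in>?V. \<Sum>u\<in>N w. h w)"
  proof -
    have "(\<Sum>u\<in>?V. sum h (N u)) = (\<Sum>w\<in>?V. \<Sum>u | u \<in> ?V \<and> u \<rightarrow>\<^bsub>G\<^esub> w. h w)"
      unfolding N_def by (rule sum.swap_restrict) auto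
    then show ?thesis unfolding N_def by (simp add: sym)
  qed
  then have "x * sum h ?V = real a * sum h ?V"
    by (simp add: h cardN sum_distrib_left)
  then have sum0: "sum h ?V = 0" using \<open>x \<noteq> real a\<close> by simp
  obtain u where u: "u \<in> ?V" "h u \<noteq> 0" using ne by blast
  have uN: "u \<notin> N u" by (auto simp: N_def dest: adj_not_same)
  \<comment> \<open>On the blocks \<open>{u}\<close>, \<open>N u\<close> and \<open>?R\<close> the
    number of common neighbours with \<open>u\<close> is constant: \<open>a\<close>,
    \<open>c\<close> and \<open>d\<close>.\<close>
  let ?R = "?V - insert u (N u)"
  have split: "sum F ?V = F u + sum F (N u) + sum F ?R" for F :: "'a \<Rightarrow> real"
  proof -
    have "sum F ?V = sum F ?R + sum F (insert u (N u))"
      using u by (intro sum.subset_diff) (auto simp: N_def)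
    then show ?thesis using uN finN by simp
  qed
  have "x\<^sup>2 * h u = (\<Sum>w\<in>N u. sum h (N w))"
  proof -
    have "(\<Sum>w\<in>N u. sum h (N w)) = (\<Sum>w\<in>N u. x * h w)"
      using h by (intro sum.cong) (auto simp: N_def)
    then show ?thesis using h[OF u(1)] by (simp add: sum_distrib_left[symmetric] power2_eq_square)
  qed
  \<comment> \<open>Exchanging the sums groups the walks of length two from \<open>u\<close> by
    their end \<open>z\<close>; there is one for each common neighbour.\<close>
  also have "\<dots> = (\<Sum>z\<in>?V. \<Sum>w | w \<in> N u \<and> w \<rightarrow>\<^bsub>G\<^esub> z. h z)"
    unfolding N_def[of w for w] by (rule sum.swap_restrict) (auto simp: finN)
  also have "\<dots> = (\<Sum>z\<in>?V. real (card (common_neighbours G u z)) * h z)"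
  proof (rule sum.cong[OF refl])
    fix z assume "z \<in> ?V"
    have "{w. w \<in> N u \<and> w \<rightarrow>\<^bsub>G\<^esub> z} = common_neighbours G u z"
      by (auto simp: common_neighbours_def N_def sym)
    then show "(\<Sum>w | w \<in> N u \<and> w \<rightarrow>\<^bsub>G\<^esub> z. h z) = real (card (common_neighbours G u z)) * h z" by simp
  qed
  also have "\<dots> = real a * h u + real c * (x * h u) + real d * sum h ?R"
  proof -
    have "common_neighbours G u u = N u" by (auto simp: common_neighbours_def N_def)
    moreover have "(\<Sum>z\<in>N u. real (card (common_neighbours G u z)) * h z) = real c * sum h (N u)"
      unfolding sum_distrib_left using adj u by (intro sum.cong) (auto simp: N_def)
    moreover have "(\<Sum>z\<in>?R. real (card (common_neighbours G u z)) * h z) = real d * sum h ?R"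
      unfolding sum_distrib_left using nonadj u by (intro sum.cong) (auto simp: N_def)
    ultimately show ?thesis by (simp add: split cardN u h)
  qed
  also have "sum h ?R = - h u - x * h u" using split[of h] sum0 h[OF u(1)] by simp
  finally have "(x\<^sup>2 - (real c - real d) * x + (real d - real a)) * h u = 0"
    by (simp add: algebra_simps)
  then show ?thesis using u by simp
qed

text \<open>\<open>c < a\<close> because an endpoint \<open>v\<close> of an edge at \<open>u\<close>
  is a neighbour of \<open>u\<close> but not of itself. Equality \<open>d = a\<close> remains
  possible, as in complete multipartite graphs.\<close>

lemma strongly_regular_eigenvalues:
  fixes G :: "('a, 'b) pre_digraph"
  assumes "graph G" and "strongly_regular G"
  obtains a c d :: nat where "d \<le> a" "c < a"
    and "\<And>x. eigenvalue (adjacency_matrix G) x \<Longrightarrow> x \<noteq> real a \<Longrightarrow>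
           x\<^sup>2 - (real c - real d) * x + (real d - real a) = 0"
proof -
  interpret graph G by fact
  obtain a c d :: nat where
    deg: "\<forall>u\<in>verts G. out_degree G u = a" and
    adj: "\<forall>u\<in>verts G. \<forall>v\<in>verts G. u \<rightarrow>\<^bsub>G\<^esub> v \<longrightarrow> card (common_neighbours G u v) = c" and
    nonadj: "\<forall>u\<in>verts G. \<forall>v\<in>verts G. u \<noteq> v \<and> \<not> u \<rightarrow>\<^bsub>G\<^esub> v \<longrightarrow>
            card (common_neighbours G u v) = d"
    using assms(2) unfolding strongly_regular_def by auto
  have sub: "common_neighbours G u v \<subseteq> {w \<in> verts G. u \<rightarrow>\<^bsub>G\<^esub> w}" for u v
    by (auto simp: common_neighbours_def)
  have card: "card {w \<in> verts G. u \<rightarrow>\<^bsub>G\<^esub> w} = a" if "u \<in> verts G" for u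
    using that deg out_degree_eq_card_neighbours by simp
  obtain u v where uv: "u \<in> verts G" "v \<in> verts G" "u \<noteq> v" "\<not> u \<rightarrow>\<^bsub>G\<^esub> v"
    using assms(2) unfolding strongly_regular_def by auto
  have "d \<le> a" using card_mono[OF _ sub[of u v]] nonadj uv card[of u] by simp
  moreover have "c < a"
  proof -
    obtain u v where uv: "u \<in> verts G" "v \<in> verts G" "u \<rightarrow>\<^bsub>G\<^esub> v"
      using assms(2) unfolding strongly_regular_def by auto
    have "v \<notin> common_neighbours G u v" by (auto simp: common_neighbours_def dest: adj_not_same)
    then have "common_neighbours G u v \<subset> {w \<in> verts G. u \<rightarrow>\<^bsub>G\<^esub> w}" using sub[of u v] uv by auto
    then have "card (common_neighbours G u v) < card {w \<in> verts G. u \<rightarrow>\<^bsub>G\<^esub> w}"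
      by (intro psubset_card_mono) simp
    then show ?thesis using adj uv card[of u] by simp
  qed
  moreover note srg_eigenvalue_quadratic[of a c d]
  ultimately show thesis using that[of d a c] deg adj nonadj by blast
qed

section \<open>Integrality and sign of the spectral parameters\<close>

lemma strongly_regular_rat_eigenvalue_Ints:
  assumes "graph G" "strongly_regular G" "eigenvalue (adjacency_matrix G) x" "x \<in> \<rat>"
  shows "x \<in> \<int>"
proof -
  obtain a c d :: nat where q: "\<And>x. eigenvalue (adjacency_matrix G) x \<Longrightarrow> x \<noteq> real a \<Longrightarrow>
           x\<^sup>2 - (real c - real d) * x + (real d - real a) = 0"
    using strongly_regular_eigenvalues[OF assms(1,2)] by metis
  show ?thesis
  proof (cases "x = real a")
    case False
    show ?thesis
      by (rule rat_root_monic_quadratic_Ints[OF assms(4) _ _ q[OF assms(3) False]]) auto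
  qed auto
qed

text \<open>By Vieta \<open>B = x + y\<close> and \<open>C = x * y\<close>: either the roots have
  opposite signs, or one is zero and the other negative. The second case covers
  \<open>d = a\<close>.\<close>

lemma quadratic_smaller_root_neg:
  fixes x y :: real
  assumes "x < y" "x\<^sup>2 - B * x + C = 0" "y\<^sup>2 - B * y + C = 0"
    and "C < 0 \<or> C = 0 \<and> B < 0"
  shows "x < 0"
proof -
  have "(x - y) * (x + y - B) = 0" using assms(2,3) by (simp add: algebra_simps power2_eq_square)
  then have B: "B = x + y" using \<open>x < y\<close> by simp
  then have "C = x * y" using assms(2) by (simp add: algebra_simps power2_eq_square)
  then show ?thesis using assms(1,4) B by (auto simp: mult_less_0_iff)
qed

text \<open>Collects everything that the later arithmetic uses about the graph.\<close>

lemma spectral_parameters_strongly_regular: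
  assumes "graph G" "strongly_regular G" and sp: "spectral_parameters G \<rho> \<sigma> f g"
  shows "\<sigma> < \<rho>" "\<sigma> < 0" "f > 0" "\<rho> \<in> \<rat> \<Longrightarrow> \<rho> \<in> \<int>" "\<sigma> \<in> \<rat> \<Longrightarrow> \<sigma> \<in> \<int>"
proof -
  let ?A = "adjacency_matrix G"
  obtain t where t: "t > \<rho>" "\<rho> > \<sigma>" "{x. eigenvalue ?A x} = {t, \<rho>, \<sigma>}"
    "eigenvalue_multiplicity ?A \<rho> = f"
    using sp unfolding spectral_parameters_def by blast
  then have ev: "eigenvalue ?A t" "eigenvalue ?A \<rho>" "eigenvalue ?A \<sigma>" by blast+
  show "\<sigma> < \<rho>" by fact
  show "\<rho> \<in> \<rat> \<Longrightarrow> \<rho> \<in> \<int>" "\<sigma> \<in> \<rat> \<Longrightarrow> \<sigma> \<in> \<int>"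
    using strongly_regular_rat_eigenvalue_Ints[OF assms(1,2)] ev by blast+
  have A: "?A \<in> carrier_mat (card (verts G)) (card (verts G))" by (simp add: adjacency_matrix_def)
  have "poly (char_poly ?A) \<rho> = 0" using ev(2) eigenvalue_root_char_poly[OF A] by simp
  moreover have "char_poly ?A \<noteq> 0" using degree_monic_char_poly[OF A] by auto
  ultimately show "f > 0" using t(4) by (metis eigenvalue_multiplicity_def order_root gr0I)
  obtain a c d :: nat where acd: "d \<le> a" "c < a"
    and q: "\<And>x. eigenvalue ?A x \<Longrightarrow> x \<noteq> real a \<Longrightarrow>
           x\<^sup>2 - (real c - real d) * x + (real d - real a) = 0"
    using strongly_regular_eigenvalues[OF assms(1,2)] by metis
  have C: "real d - real a < 0 \<or> real d - real a = 0 \<and> real c - real d < 0" using acd by auto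
  have neg: "x < 0" if "eigenvalue ?A x" "eigenvalue ?A y" "x \<noteq> real a" "y \<noteq> real a" "x < y" for x y
    using quadratic_smaller_root_neg[OF that(5) q q C] that by blast
  \<comment> \<open>At most one of the three eigenvalues equals \<open>a\<close>. If it is not
    \<sigma>, then \<sigma> is the smaller of two roots of the quadratic; if it is, then \<rho> is
    the smaller root, so \<open>\<rho> < 0\<close> and \<sigma> lies below it.\<close>
  show "\<sigma> < 0"
    using neg[of \<sigma> \<rho>] neg[of \<sigma> t] neg[of \<rho> t] ev t(1,2) by force
qed

text \<open>The ordering makes \<sigma> and \<open>a\<close> the minimum and maximum of the
  spectrum, which leaves \<rho>; the multiplicities follow. This removes the existential quantifier
  in \<open>feasible\<close>.\<close>

lemma spectral_parameters_unique:
  assumes "spectral_parameters G \<rho> \<sigma> f g" "spectral_parameters G \<rho>' \<sigma>' f' g'"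
  shows "\<rho>' = \<rho> \<and> \<sigma>' = \<sigma> \<and> f' = f \<and> g' = g"
proof -
  obtain a where a: "a > \<rho>" "\<rho> > \<sigma>" "{x. eigenvalue (adjacency_matrix G) x} = {a, \<rho>, \<sigma>}"
    using assms(1) unfolding spectral_parameters_def by blast
  obtain a' where a': "a' > \<rho>'" "\<rho>' > \<sigma>'" "{x. eigenvalue (adjacency_matrix G) x} = {a', \<rho>', \<sigma>'}"
    using assms(2) unfolding spectral_parameters_def by blast
  have eq: "{a, \<rho>, \<sigma>} = {a', \<rho>', \<sigma>'}" using a(3) a'(3) by simp
  have "Min {a, \<rho>, \<sigma>} = \<sigma>" "Min {a', \<rho>', \<sigma>'} = \<sigma>'" "Max {a, \<rho>, \<sigma>} = a" "Max {a', \<rho>', \<sigma>'} = a'"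
    using a(1,2) a'(1,2) by auto
  then have "\<sigma>' = \<sigma>" "a' = a" using eq by simp_all
  moreover from this have "\<rho>' = \<rho>" using eq a(1,2) a'(1,2) by auto
  ultimately show ?thesis using assms by (auto simp: spectral_parameters_def)
qed

section \<open>Feasible parameters\<close>

text \<open>The natural numbers \<open>r\<^sub>1, r\<^sub>2\<close> are the replication numbers of a design and of its complement.\<close>

lemma feasible_parameters_iff_replication_numbers:
  fixes \<rho> \<sigma> :: real and f g \<mu> :: nat
  defines "b \<equiv> real (f + g + 1)" and "v \<equiv> real (f + 1)" and "M \<equiv> (\<rho> - \<sigma>) * real \<mu>"
  shows "feasible_parameters \<rho> \<sigma> f g \<mu> \<longleftrightarrow>
    (\<exists>r1 r2 :: nat. real r1 + real r2 = b \<and> real r1 * real r2 * v = b * M * real f \<and>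
      (\<forall>r\<in>{r1, r2}. real r - M \<in> \<nat> \<and> v * real r / b \<in> \<nat> \<and> v * real r / b + \<sigma> * real \<mu> \<in> \<nat>))"
    (is "?L \<longleftrightarrow> ?R")
proof -
  have b: "b > 0" and v: "v > 0" and vf: "v = real f + 1" and bg: "b = v + real g"
    by (simp_all add: b_def v_def)
  define Q :: "complex \<Rightarrow> complex" where
    "Q l = l\<^sup>2 - of_real (b - 2 * M) * l + of_real (M * (M - b / v))" for l
  define L1 :: "complex \<Rightarrow> complex" where
    "L1 l = 1 / of_real b * (of_real v * (l + of_real (\<rho> * real \<mu>)) + of_real (real g * \<sigma> * real \<mu>))" for l
  have feas: "?L \<longleftrightarrow> (\<forall>l. Q l = 0 \<longrightarrow>
      {of_real b, of_real v, l + of_real M, L1 l - of_real (\<sigma> * real \<mu>), l, L1 l, L1 l + of_nat \<mu>} \<subseteq> \<nat> \<and>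
      of_real b * (L1 l - of_real (\<sigma> * real \<mu>)) = (l + of_real M) * of_real v \<and>
      (l + of_real M) * (L1 l - of_real (\<sigma> * real \<mu>) - 1) = l * (of_real v - 1))"
    unfolding feasible_parameters_def Q_def L1_def M_def b_def v_def Let_def
    by (simp only: of_real_of_nat_eq mult.assoc)
  \<comment> \<open>As \<open>\<rho> * \<mu> = M + \<sigma> * \<mu>\<close> and
    \<open>b = v + g\<close>, the terms in \<open>\<sigma> * \<mu>\<close> combine to
    \<open>b * \<sigma> * \<mu>\<close>.\<close>
  have L1: "L1 l = of_real (v / b) * (l + of_real M) + of_real (\<sigma> * real \<mu>)" for l
  proof -
    have "b * (\<sigma> * real \<mu>) = v * (\<sigma> * real \<mu>) + real g * \<sigma> * real \<mu>" by (simp add: bg algebra_simps)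
    then have "complex_of_real b * of_real (\<sigma> * real \<mu>)
        = of_real v * of_real (\<sigma> * real \<mu>) + of_real (real g * \<sigma> * real \<mu>)"
      by (metis of_real_add of_real_mult)
    then have "of_real v * (l + of_real (\<rho> * real \<mu>)) + of_real (real g * \<sigma> * real \<mu>)
        = of_real v * (l + of_real M) + of_real b * of_real (\<sigma> * real \<mu>)"
      by (simp add: M_def algebra_simps)
    then show ?thesis using b by (simp add: L1_def field_simps)
  qed
  have Q: "Q l = (l + of_real M)\<^sup>2 - of_real b * (l + of_real M) + of_real (b * M * real f / v)" for l
  proof -
    have "b * M * real f / v = b * M - b * M / v" using v by (simp add: field_simps vf)
    then have "complex_of_real (b * M * real f / v) = of_real (b * M) - of_real (b * M / v)"
      by (metis of_real_diff)
    then show ?thesis unfolding Q_def by (simp add: algebra_simps power2_eq_square)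
  qed
  have of_real_Nats: "of_real x \<in> (\<nat> :: complex set) \<longleftrightarrow> x \<in> \<nat>" for x
    by (auto elim!: Nats_cases) (metis Nats_cases of_nat_in_Nats of_real_eq_iff of_real_of_nat_eq)
  show ?thesis
  proof
    assume ?L
    \<comment> \<open>A complex square root of the discriminant, which is not yet known to be
      nonnegative. The choices \<open>e = 1\<close> and \<open>e = -1\<close> in \<open>R\<close>
      reach both roots; that they are real comes only from their lying in \<nat>.\<close>
    define s where "s = csqrt (of_real (b * (b - 4 * M * real f / v)))"
    define R where "R = (\<lambda>e. (of_real b + e * s) / 2)"
    have R: "Q (R e - of_real M) = 0" if "e\<^sup>2 = 1" for e
    proof -
      have "(e * s)\<^sup>2 = of_real (b * (b - 4 * M * real f / v))"
        by (simp add: power_mult_distrib that s_def)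
      moreover have "Q (R e - of_real M) = ((e * s)\<^sup>2 - of_real (b * (b - 4 * M * real f / v))) / 4"
        by (simp add: Q R_def power2_eq_square field_simps)
      ultimately show ?thesis by simp
    qed
    have *: "R e \<in> \<nat>" "R e - of_real M \<in> \<nat>" "of_real (v / b) * R e \<in> \<nat>"
      "of_real (v / b) * R e + of_real (\<sigma> * real \<mu>) \<in> \<nat>" if "e\<^sup>2 = 1" for e
      using \<open>?L\<close>[unfolded feas, rule_format, OF R[OF that]] by (simp_all add: L1)
    obtain r1 r2 where r: "R 1 = of_nat r1" "R (-1) = of_nat r2"
      using *(1)[of 1] *(1)[of "-1"] by (auto elim!: Nats_cases)
    have sum: "R 1 + R (-1) = of_real b" by (simp add: R_def field_simps)
    then have "complex_of_real (real r1 + real r2) = of_real b" by (simp add: r)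
    then have sum': "real r1 + real r2 = b" by (simp only: of_real_eq_iff)
    have "(R 1)\<^sup>2 - of_real b * R 1 + of_real (b * M * real f / v) = 0"
      using R[of 1] by (simp add: Q)
    then have "complex_of_real ((real r1)\<^sup>2 - b * real r1 + b * M * real f / v) = of_real 0"
      by (simp add: r)
    then have "(real r1)\<^sup>2 - b * real r1 + b * M * real f / v = 0" by (simp only: of_real_eq_iff)
    \<comment> \<open>Substituting \<open>b = r1 + r2\<close> into the equation for
      \<open>r1\<close> leaves \<open>- r1 * r2\<close> plus the constant term.\<close>
    then have "real r1 * real r2 = b * M * real f / v"
      unfolding sum'[symmetric] by (simp add: algebra_simps power2_eq_square)
    then have prod: "real r1 * real r2 * v = b * M * real f" using v by simp
    have "real r - M \<in> \<nat> \<and> v * real r / b \<in> \<nat> \<and> v * real r / b + \<sigma> * real \<mu> \<in> \<nat>" if "r \<in> {r1, r2}" for r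
    proof -
      define e :: complex where "e = (if r = r1 then 1 else -1)"
      have e: "e\<^sup>2 = 1" "R e = of_nat r" using r that by (auto simp: e_def)
      have "complex_of_real (real r - M) \<in> \<nat>" "complex_of_real (v * real r / b) \<in> \<nat>"
        "complex_of_real (v * real r / b + \<sigma> * real \<mu>) \<in> \<nat>"
        using *[OF e(1)] by (simp_all add: e(2))
      then show ?thesis by (simp only: of_real_Nats)
    qed
    then show ?R using sum' prod by blast
  next
    assume ?R
    then obtain r1 r2 :: nat where sum: "real r1 + real r2 = b"
      and prod: "real r1 * real r2 * v = b * M * real f"
      and nat: "\<And>r. r \<in> {r1, r2} \<Longrightarrow> real r - M \<in> \<nat> \<and> v * real r / b \<in> \<nat> \<and> v * real r / b + \<sigma> * real \<mu> \<in> \<nat>"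
      by blast
    have prod': "b * M * real f / v = real r1 * real r2" using prod v by (simp add: field_simps)
    show ?L unfolding feas
    proof (intro allI impI)
      fix l assume l: "Q l = 0"
      \<comment> \<open>The sum and product of \<open>r1\<close> and \<open>r2\<close> are the
        coefficients of the quadratic in \<open>l + M\<close>, so it factors.\<close>
      have "(l + of_real M - of_nat r1) * (l + of_real M - of_nat r2) = 0"
        using l[unfolded Q prod', folded sum] by (simp add: algebra_simps power2_eq_square)
      then obtain r where r: "r \<in> {r1, r2}" and lr: "l + of_real M = of_nat r" by fastforce
      have l': "l = of_real (real r - M)" using lr by (simp add: algebra_simps)
      have k: "L1 l - of_real (\<sigma> * real \<mu>) = of_real (v * real r / b)"
        and l1: "L1 l = of_real (v * real r / b + \<sigma> * real \<mu>)"
        by (simp_all add: L1 lr)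
      \<comment> \<open>Multiplied by \<open>v / b\<close>, the quadratic for \<open>r\<close>
        becomes \<open>r * (k - 1) = (r - M) * (v - 1)\<close>, because
        \<open>f = v - 1\<close>.\<close>
      have "(real r)\<^sup>2 + real r1 * real r2 = b * real r"
        using r unfolding sum[symmetric] by (auto simp: algebra_simps power2_eq_square)
      then have "v * (real r)\<^sup>2 + b * M * real f = v * b * real r"
        unfolding prod[symmetric] by (simp add: algebra_simps) (metis distrib_left mult.left_commute)
      then have "real r * (v * real r / b - 1) = (real r - M) * (v - 1)"
        using b by (simp add: field_simps power2_eq_square vf)
      then have "complex_of_real (real r * (v * real r / b - 1)) = of_real ((real r - M) * (v - 1))"
        by (simp only:)
      moreover have "complex_of_real b * of_real (v * real r / b) = of_nat r * of_real v" using b by simp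
      moreover have "complex_of_real b \<in> \<nat>" "complex_of_real v \<in> \<nat>" by (simp_all add: b_def v_def)
      moreover have "L1 l \<in> \<nat>" using nat[OF r] by (simp only: l1 of_real_Nats)
      moreover have "l \<in> \<nat>" using nat[OF r] by (simp only: l' of_real_Nats)
      moreover have "complex_of_real (v * real r / b) \<in> \<nat>" using nat[OF r] by (simp only: of_real_Nats)
      ultimately show "{of_real b, of_real v, l + of_real M, L1 l - of_real (\<sigma> * real \<mu>), l, L1 l, L1 l + of_nat \<mu>} \<subseteq> \<nat> \<and>
        of_real b * (L1 l - of_real (\<sigma> * real \<mu>)) = (l + of_real M) * of_real v \<and>
        (l + of_real M) * (L1 l - of_real (\<sigma> * real \<mu>) - 1) = l * (of_real v - 1)"
        unfolding lr k by (simp add: l')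
    qed
  qed
qed

section \<open>From replication numbers to the arithmetic conditions\<close>

text \<open>A negative \<open>x\<close> would need a positive \<open>y\<close>, making the product
  negative.\<close>

lemma nonneg_of_sum_prod_nonneg:
  fixes x y :: real
  assumes "x + y \<ge> 0" "x * y \<ge> 0"
  shows "x \<ge> 0"
  using assms by (smt (verit) mult_neg_pos)

lemma Nats_if_Ints_nonneg: "x \<in> \<int> \<Longrightarrow> x \<ge> 0 \<Longrightarrow> x \<in> \<nat>" for x :: real
  by (auto simp: Nats_altdef2)

text \<open>The right-hand side is \<open>k\<^sup>2 - v * k + M * f * v / b\<close> at
  \<open>k = - \<sigma> * \<mu>\<close>; it arises from the bound on multiplying by
  \<open>\<sigma>\<^sup>2\<close> and by \<mu>.\<close>

lemma quadratic_at_minus_sigma_mu: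
  fixes \<rho> \<sigma> f g \<mu> :: real
  assumes "f \<ge> 0" "g \<ge> 0" "\<sigma> < 0" "\<mu> > 0"
  shows "- ((f + 1) / (f + g + 1)) * ((f * \<rho> + (g + 1) * \<sigma>) / \<sigma>\<^sup>2) \<le> \<mu> \<longleftrightarrow>
    0 \<le> (\<sigma> * \<mu>)\<^sup>2 + (f + 1) * (\<sigma> * \<mu>) + (f + 1) * ((\<rho> - \<sigma>) * \<mu>) * f / (f + g + 1)"
    (is "?l \<longleftrightarrow> 0 \<le> ?P")
proof -
  define b where "b = f + g + 1"
  have b: "b > 0" and g: "g + 1 = b - f" using assms by (simp_all add: b_def)
  have "?l \<longleftrightarrow> - ((f + 1) / b * (f * \<rho> + (b - f) * \<sigma>)) \<le> \<mu> * \<sigma>\<^sup>2"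
  proof -
    have "- ((f + 1) / b) * ((f * \<rho> + (b - f) * \<sigma>) / \<sigma>\<^sup>2)
        = - ((f + 1) / b * (f * \<rho> + (b - f) * \<sigma>)) / \<sigma>\<^sup>2" by simp
    then show ?thesis using assms(3) unfolding g b_def[symmetric] by (simp only: pos_divide_le_eq zero_less_power2)
  qed
  also have "\<dots> \<longleftrightarrow> 0 \<le> \<mu> * (\<mu> * \<sigma>\<^sup>2 + (f + 1) / b * (f * \<rho> + (b - f) * \<sigma>))"
    using assms(4) by (auto simp: zero_le_mult_iff)
  also have "\<mu> * (\<mu> * \<sigma>\<^sup>2 + (f + 1) / b * (f * \<rho> + (b - f) * \<sigma>)) = ?P"
    unfolding b_def[symmetric] using b by (simp add: field_simps power2_eq_square)
  finally show ?thesis .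
qed

text \<open>Pure arithmetic: the graph enters only through \<open>f > 0\<close>, the order and sign
  conditions, and the passage from rational to integer.\<close>

lemma feasible_parameters_iff:
  fixes \<rho> \<sigma> :: real and f g \<mu> :: nat
  assumes "f > 0" "\<sigma> < \<rho>" "\<sigma> < 0" "\<mu> > 0"
    and int\<rho>: "\<rho> \<in> \<rat> \<Longrightarrow> \<rho> \<in> \<int>" and int\<sigma>: "\<sigma> \<in> \<rat> \<Longrightarrow> \<sigma> \<in> \<int>"
  shows "feasible_parameters \<rho> \<sigma> f g \<mu> \<longleftrightarrow>
    (\<exists>p s :: int.
       (\<rho> = of_int p \<and> \<sigma> = of_int s) \<and>
       (- (real (f + 1) / real (f + g + 1)) * ((real f * \<rho> + real (g + 1) * \<sigma>) / \<sigma>\<^sup>2) \<le> real \<mu> \<and>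
        real \<mu> \<le> - (real (f + 1) / (2 * \<sigma>))) \<and>
       int (f + 1) dvd int g * (p - s) * int \<mu> \<and>
       int (f + g + 1) dvd int f * int g * (p - s) * int \<mu> \<and>
       (\<exists>m :: int. real (f + g + 1) *
            (real (f + g + 1) - 4 * real f * (\<rho> - \<sigma>) * real \<mu> / real (f + 1)) = (of_int m)\<^sup>2))"
    (is "_ \<longleftrightarrow> ?R")
proof -
  define b v M where "b = real (f + g + 1)" and "v = real (f + 1)" and "M = (\<rho> - \<sigma>) * real \<mu>"
  \<comment> \<open>Since \<open>\<lambda>\<^sub>1 = k - x\<close>, this is the value that both
    block sizes must reach.\<close>
  define x where "x = - \<sigma> * real \<mu>"
  have b: "b > 0" and v: "v > 0" and vf: "v = real f + 1" and bg: "b = v + real g"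
    and M: "M > 0" and x: "x > 0"
    using assms by (simp_all add: b_def v_def M_def x_def mult_neg_pos)
  \<comment> \<open>The two bounds say that the quadratic whose roots are the block sizes is
    nonnegative at \<open>x\<close>, and that \<open>x\<close> is at most half the sum of these
    roots. Together they place \<open>x\<close> at or below both roots.\<close>
  have lower: "- (real (f + 1) / real (f + g + 1)) * ((real f * \<rho> + real (g + 1) * \<sigma>) / \<sigma>\<^sup>2) \<le> real \<mu>
      \<longleftrightarrow> 0 \<le> x\<^sup>2 - v * x + v * M * real f / b"
    using quadratic_at_minus_sigma_mu[of "real f" "real g" \<sigma> "real \<mu>" \<rho>] assms
    by (simp add: x_def v_def b_def M_def algebra_simps)
  have upper: "real \<mu> \<le> - (real (f + 1) / (2 * \<sigma>)) \<longleftrightarrow> 2 * x \<le> v"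
    using assms(3) by (auto simp: x_def v_def field_simps)
  have \<Delta>: "real (f + g + 1) * (real (f + g + 1) - 4 * real f * (\<rho> - \<sigma>) * real \<mu> / real (f + 1))
      = b\<^sup>2 - 4 * (b * M * real f / v)"
    unfolding b_def[symmetric] v_def[symmetric] M_def by (simp add: algebra_simps power2_eq_square)
  show ?thesis unfolding feasible_parameters_iff_replication_numbers
    unfolding b_def[symmetric] v_def[symmetric] M_def[symmetric] lower[unfolded v_def[symmetric] b_def[symmetric]]
      upper[unfolded v_def[symmetric]] \<Delta>[unfolded v_def[symmetric] b_def[symmetric]]
  proof
    assume "\<exists>r1 r2 :: nat. real r1 + real r2 = b \<and> real r1 * real r2 * v = b * M * real f \<and>
      (\<forall>r\<in>{r1, r2}. real r - M \<in> \<nat> \<and> v * real r / b \<in> \<nat> \<and> v * real r / b + \<sigma> * real \<mu> \<in> \<nat>)"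
    then obtain r1 r2 :: nat where sum: "real r1 + real r2 = b"
      and prod: "real r1 * real r2 * v = b * M * real f"
      and l: "real r1 - M \<in> \<nat>"
      and k: "v * real r1 / b \<in> \<nat>" "v * real r2 / b \<in> \<nat>"
      and l1: "v * real r1 / b + \<sigma> * real \<mu> \<in> \<nat>" "v * real r2 / b + \<sigma> * real \<mu> \<in> \<nat>"
      by blast
    obtain k1 k2 :: nat where k1: "v * real r1 / b = real k1" and k2: "v * real r2 / b = real k2"
      using k by (auto elim!: Nats_cases)
    have xk: "x \<le> real k1" "x \<le> real k2"
      using l1 unfolding k1 k2 by (auto simp: x_def elim!: Nats_cases)
    have ksum: "real k1 + real k2 = v"
    proof -
      have "real k1 + real k2 = v * (real r1 + real r2) / b"
        unfolding k1[symmetric] k2[symmetric] by (simp add: add_divide_distrib distrib_left)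
      then show ?thesis using b by (simp add: sum)
    qed
    have kprod: "real k1 * real k2 = v * M * real f / b"
    proof -
      have "real k1 * real k2 = v * (real r1 * real r2 * v) / b\<^sup>2"
        unfolding k1[symmetric] k2[symmetric] by (simp add: power2_eq_square)
      then show ?thesis using b by (simp add: prod power2_eq_square)
    qed
    \<comment> \<open>\<open>\<sigma> * \<mu> = \<lambda>\<^sub>1 - k\<close> and
      \<open>M = r - \<lambda>\<close> are integers. Dividing by \<mu> makes \<sigma> and \<rho>
      rational, hence integers by hypothesis.\<close>
    have "\<sigma> * real \<mu> \<in> \<int>"
      using Ints_diff[OF subsetD[OF Nats_subset_Ints l1(1)] subsetD[OF Nats_subset_Ints k(1)]] by simp
    moreover have M_int: "M \<in> \<int>" using Ints_diff[OF _ subsetD[OF Nats_subset_Ints l], of "real r1"] by simp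
    ultimately have "\<rho> * real \<mu> \<in> \<int>"
      using Ints_add[of M "\<sigma> * real \<mu>"] by (simp add: M_def algebra_simps)
    have rat: "y \<in> \<rat>" if "y * real \<mu> \<in> \<int>" for y
    proof -
      have "y * real \<mu> / real \<mu> \<in> \<rat>" using that Ints_subset_Rats by (intro Rats_divide) auto
      then show ?thesis using assms(4) by simp
    qed
    obtain p s :: int where p: "\<rho> = of_int p" and s: "\<sigma> = of_int s"
      using int\<rho>[OF rat] int\<sigma>[OF rat] \<open>\<rho> * real \<mu> \<in> \<int>\<close> \<open>\<sigma> * real \<mu> \<in> \<int>\<close> by (auto elim!: Ints_cases)
    define X where "X = (p - s) * int \<mu>"
    have MX: "M = of_int X" by (simp add: M_def X_def p s)
    have "real_of_int (int r1 * int r2 * int (f + 1)) = of_int (int (f + g + 1) * X * int f)"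
      using prod by (simp add: MX b_def v_def)
    then have "int r1 * int r2 * int (f + 1) = int (f + g + 1) * X * int f" by (simp only: of_int_eq_iff)
    \<comment> \<open>Rests on \<open>(f + 1) * (f + g) = f * (f + g + 1) + g\<close>.\<close>
    then have "int g * X = int (f + 1) * (int f * X + int g * X - int r1 * int r2)"
      by (simp add: algebra_simps)
    then have c: "int (f + 1) dvd int g * (p - s) * int \<mu>"
      unfolding X_def by (metis dvd_triv_left mult.assoc)
    have "real k1 * real k2 * b = v * M * real f" using kprod b by simp
    then have "real_of_int (int k1 * int k2 * int (f + g + 1)) = of_int (int (f + 1) * X * int f)"
      by (simp add: MX b_def v_def)
    then have "int k1 * int k2 * int (f + g + 1) = int (f + 1) * X * int f" by (simp only: of_int_eq_iff)
    then have "int f * int g * X = int (f + g + 1) * (X * int f - int k1 * int k2)"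
      by (simp add: algebra_simps)
    then have d: "int (f + g + 1) dvd int f * int g * (p - s) * int \<mu>"
      unfolding X_def by (metis dvd_triv_left mult.assoc)
    have "0 \<le> (real k1 - x) * (real k2 - x)" using xk by simp
    also have "\<dots> = x\<^sup>2 - (real k1 + real k2) * x + real k1 * real k2"
      by (simp add: algebra_simps power2_eq_square)
    also have "\<dots> = x\<^sup>2 - v * x + v * M * real f / b" unfolding kprod ksum ..
    finally have low: "0 \<le> x\<^sup>2 - v * x + v * M * real f / b" .
    have up: "2 * x \<le> v" using xk ksum by simp
    have "b * M * real f / v = real r1 * real r2" using prod v by (simp add: field_simps)
    \<comment> \<open>The square root of \<Delta> is the difference of the two replication
      numbers.\<close>
    then have "b\<^sup>2 - 4 * (b * M * real f / v) = (of_int (int r1 - int r2))\<^sup>2"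
      unfolding sum[symmetric] by (simp add: algebra_simps power2_eq_square)
    then show "\<exists>p s. (\<rho> = of_int p \<and> \<sigma> = of_int s) \<and>
       (0 \<le> x\<^sup>2 - v * x + v * M * real f / b \<and> 2 * x \<le> v) \<and>
       int (f + 1) dvd int g * (p - s) * int \<mu> \<and>
       int (f + g + 1) dvd int f * int g * (p - s) * int \<mu> \<and>
       (\<exists>m :: int. b\<^sup>2 - 4 * (b * M * real f / v) = (of_int m)\<^sup>2)"
      using p s c d low up by blast
  next
    assume "\<exists>p s. (\<rho> = of_int p \<and> \<sigma> = of_int s) \<and>
       (0 \<le> x\<^sup>2 - v * x + v * M * real f / b \<and> 2 * x \<le> v) \<and>
       int (f + 1) dvd int g * (p - s) * int \<mu> \<and>
       int (f + g + 1) dvd int f * int g * (p - s) * int \<mu> \<and>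
       (\<exists>m :: int. b\<^sup>2 - 4 * (b * M * real f / v) = (of_int m)\<^sup>2)"
    then obtain p s m :: int where p: "\<rho> = of_int p" and s: "\<sigma> = of_int s"
      and low: "0 \<le> x\<^sup>2 - v * x + v * M * real f / b" and up: "2 * x \<le> v"
      and c: "int (f + 1) dvd int g * (p - s) * int \<mu>"
      and d: "int (f + g + 1) dvd int f * int g * (p - s) * int \<mu>"
      and m: "b\<^sup>2 - 4 * (b * M * real f / v) = (of_int m)\<^sup>2"
      by blast
    define X where "X = (p - s) * int \<mu>"
    have MX: "M = of_int X" by (simp add: M_def X_def p s)
    obtain c' where "int g * X = int (f + 1) * c'" using c by (auto simp: X_def mult.assoc elim: dvdE)
    then have "real_of_int (int g * X) = of_int (int (f + 1) * c')" by (simp only:)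
    then have c': "real g * M = v * of_int c'" by (simp add: MX v_def)
    obtain d' where "int f * int g * X = int (f + g + 1) * d'"
      using d by (auto simp: X_def mult.assoc elim: dvdE)
    then have "real_of_int (int f * int g * X) = of_int (int (f + g + 1) * d')" by (simp only:)
    then have d': "real f * real g * M = b * of_int d'" by (simp add: MX b_def)
    \<comment> \<open>Through \<open>b = v + g\<close>, conditions (c) and (d) make the constant
      terms of the quadratics for \<open>r\<close> and \<open>k\<close> integers.\<close>
    have "b * M * real f / v = real_of_int (X * int f + c' * int f)"
    proof -
      have "b * M * real f = v * M * real f + (real g * M) * real f" by (simp add: bg algebra_simps)
      then show ?thesis unfolding c' using v by (simp add: MX field_simps)
    qed
    then have rprod_int: "b * M * real f / v \<in> \<int>" by (metis Ints_of_int)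
    have "v * M * real f / b = real_of_int (X * int f - d')"
    proof -
      have "v * M * real f = b * M * real f - real f * real g * M" by (simp add: bg algebra_simps)
      then show ?thesis unfolding d' using b by (simp add: MX field_simps)
    qed
    then have kprod_int: "v * M * real f / b \<in> \<int>" by (metis Ints_of_int)
    have bv_int: "b \<in> \<int>" "v \<in> \<int>" by (simp_all add: b_def v_def)
    \<comment> \<open>Stated for a pair \<open>r\<close>, \<open>r'\<close> so that it serves both
      roots. Assuming only \<open>r \<in> \<rat>\<close> avoids a parity argument for
      \<open>(b + m) / 2\<close>: integrality comes from the monic quadratic.\<close>
    have root: "r \<in> \<nat> \<and> r - M \<in> \<nat> \<and> v * r / b \<in> \<nat> \<and> v * r / b + \<sigma> * real \<mu> \<in> \<nat>"
      if sum: "r + r' = b" and prod: "r * r' = b * M * real f / v" and "r \<in> \<rat>" for r r'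
    proof -
      have "r\<^sup>2 - (r + r') * r + r * r' = 0" by (simp add: algebra_simps power2_eq_square)
      then have rint: "r \<in> \<int>"
        unfolding sum prod by (rule rat_root_monic_quadratic_Ints[OF \<open>r \<in> \<rat>\<close> bv_int(1) rprod_int])
      have r0: "r \<ge> 0"
        using nonneg_of_sum_prod_nonneg[of r r'] sum prod b v M by simp
      let ?k = "v * r / b" and ?k' = "v * r' / b"
      have ksum: "?k + ?k' = v" 
      proof -
        have "?k + ?k' = v * (r + r') / b" by (simp add: add_divide_distrib distrib_left)
        then show ?thesis using b by (simp add: sum)
      qed
      have kprod: "?k * ?k' = v * M * real f / b"
      proof -
        have "?k * ?k' = v\<^sup>2 * (r * r') / b\<^sup>2" by (simp add: power2_eq_square)
        then show ?thesis unfolding prod using b v by (simp add: power2_eq_square)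
      qed
      have "?k\<^sup>2 - v * ?k + v * M * real f / b = ?k\<^sup>2 - (?k + ?k') * ?k + ?k * ?k'"
        by (simp only: ksum kprod)
      then have kq: "?k\<^sup>2 - v * ?k + v * M * real f / b = 0"
        by (simp add: algebra_simps power2_eq_square)
      have "?k \<in> \<rat>" using \<open>r \<in> \<rat>\<close> bv_int Ints_subset_Rats by (intro Rats_divide Rats_mult) auto
      then have kint: "?k \<in> \<int>" by (rule rat_root_monic_quadratic_Ints[OF _ bv_int(2) kprod_int kq])
      have "(?k - x) * (?k' - x) = ?k * ?k' - (?k + ?k') * x + x\<^sup>2"
        by (simp only: power2_eq_square) (simp only: algebra_simps)
      then have "0 \<le> (?k - x) * (?k' - x)" using low unfolding ksum kprod by simp
      \<comment> \<open>\<open>?k - x\<close> and \<open>?k' - x\<close> have sum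
        \<open>v - 2 * x\<close> and a nonnegative product, by the two halves of (b).\<close>
      then have xk: "x \<le> ?k" using nonneg_of_sum_prod_nonneg[of "?k - x" "?k' - x"] ksum up by simp
      \<comment> \<open>\<open>?k\<close> is an integer and at least \<open>x > 0\<close>.\<close>
      have k1: "?k \<ge> 1"
      proof -
        obtain z where z: "?k = of_int z" using kint by (auto elim: Ints_cases)
        then show ?thesis using xk x by simp
      qed
      \<comment> \<open>As \<open>f > 0\<close>, nonnegativity of \<open>\<lambda> = r - M\<close>
        can be read off from \<open>\<lambda> * f = r * (k - 1)\<close>.\<close>
      have "(r - M) * real f = r * (?k - 1)"
      proof -
        have "b * M * real f = v * (r * r')" using prod v by simp
        also have "r' = b - r" using sum by simp
        finally have "b * M * real f = v * (r * (b - r))" .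
        then have "M * real f = v * r - r * ?k" using b by (simp add: field_simps power2_eq_square)
        then show ?thesis by (simp add: vf algebra_simps)
      qed
      also have "\<dots> \<ge> 0" using r0 k1 by simp
      finally have "r - M \<ge> 0" using assms(1) by (simp add: zero_le_mult_iff)
      moreover have "?k + \<sigma> * real \<mu> \<in> \<int>" using kint by (simp add: s)
      moreover have "?k + \<sigma> * real \<mu> \<ge> 0" using xk by (simp add: x_def)
      ultimately show ?thesis using rint r0 kint k1 by (auto intro!: Nats_if_Ints_nonneg simp: MX)
    qed
    \<comment> \<open>The roots of the quadratic for \<open>r\<close>, with \<open>m\<close> as
      square root of its discriminant; a negative \<open>m\<close> only swaps them.\<close>
    define r1 r2 where "r1 = (b - of_int m) / 2" and "r2 = (b + of_int m) / 2"
    have sum: "r1 + r2 = b" by (simp add: r1_def r2_def field_simps)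
    have prod: "r1 * r2 = b * M * real f / v"
    proof -
      have "r1 * r2 = (b\<^sup>2 - (of_int m)\<^sup>2) / 4" by (simp add: r1_def r2_def power2_eq_square algebra_simps)
      then show ?thesis unfolding m[symmetric] by simp
    qed
    have rat: "r1 \<in> \<rat>" "r2 \<in> \<rat>" unfolding r1_def r2_def b_def by (auto intro!: Rats_divide)
    have root1: "r1 \<in> \<nat> \<and> r1 - M \<in> \<nat> \<and> v * r1 / b \<in> \<nat> \<and> v * r1 / b + \<sigma> * real \<mu> \<in> \<nat>"
      by (rule root[OF sum prod rat(1)])
    have root2: "r2 \<in> \<nat> \<and> r2 - M \<in> \<nat> \<and> v * r2 / b \<in> \<nat> \<and> v * r2 / b + \<sigma> * real \<mu> \<in> \<nat>"
      by (rule root[of r2 r1]) (use sum prod rat in \<open>simp_all add: ac_simps\<close>)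
    obtain n1 n2 where "r1 = real n1" "r2 = real n2" using root1 root2 by (auto elim!: Nats_cases)
    moreover have "r1 * r2 * v = b * M * real f" using prod v by simp
    ultimately show "\<exists>r1 r2 :: nat. real r1 + real r2 = b \<and> real r1 * real r2 * v = b * M * real f \<and>
      (\<forall>r\<in>{r1, r2}. real r - M \<in> \<nat> \<and> v * real r / b \<in> \<nat> \<and> v * real r / b + \<sigma> * real \<mu> \<in> \<nat>)"
      using root1 root2 sum by (intro exI[of _ n1] exI[of _ n2]) simp
  qed
qed

theorem theorem2p3:
  fixes G :: "('a, 'b) pre_digraph" and \<rho> \<sigma> :: real and f g \<mu> :: nat
  assumes "graph G" and "connected G" and "strongly_regular G"
    and "spectral_parameters G \<rho> \<sigma> f g"
    and "\<mu> > 0"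
  shows "feasible G \<mu> \<longleftrightarrow>
    (\<exists>p s :: int.
       (\<rho> = of_int p \<and> \<sigma> = of_int s) \<and>
       (- (real (f + 1) / real (f + g + 1)) * ((real f * \<rho> + real (g + 1) * \<sigma>) / \<sigma>\<^sup>2) \<le> real \<mu> \<and>
        real \<mu> \<le> - (real (f + 1) / (2 * \<sigma>))) \<and>
       int (f + 1) dvd int g * (p - s) * int \<mu> \<and>
       int (f + g + 1) dvd int f * int g * (p - s) * int \<mu> \<and>
       (\<exists>m :: int. real (f + g + 1) *
            (real (f + g + 1) - 4 * real f * (\<rho> - \<sigma>) * real \<mu> / real (f + 1)) = (of_int m)\<^sup>2))"
proof -
  have "feasible G \<mu> \<longleftrightarrow> feasible_parameters \<rho> \<sigma> f g \<mu>"
    using assms(4) spectral_parameters_unique[OF assms(4)] unfolding feasible_def by metis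
  also note feasible_parameters_iff
      [OF spectral_parameters_strongly_regular(3,1,2)[OF assms(1,3,4)] assms(5)
          spectral_parameters_strongly_regular(4,5)[OF assms(1,3,4)]]
  finally show ?thesis .
qed

end
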